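(* Let $\alpha:A^{\Delta}\to(H,V)$ be a homomorphism into a finite forest algebra whose horizontal monoid $H$ is idempotent and commutative. Then $\alpha$ is an $(\mathsf{EF},\mathsf{EX})$-homomorphism if and only if it is nonconfusing.
   Context: $A^{\Delta}=(H_A,V_A)$ is the free forest algebra over the finite alphabet $A$: $H_A$ is the monoid of forests (finite ordered sequences of finite ordered $A$-labelled trees) under concatenation $+$; $V_A$ the monoid of contexts (forests with one leaf replaced by a hole) under substitution, acting on $H_A$ by substitution. $as$ denotes the tree with root $a$ and child forest $s$. A forest algebra $(H,V)$ is an additive monoid $H$, a monoid $V$, and a faithful left action of $V$ on $H$ such that the maps $g\mapsto g+h$, $g\mapsto h+g$ lie in $V$; homomorphisms preserve everything and homomorphisms from $A^{\Delta}$ are determined by the images of $a\square$. When $H$ is idempotent and commutative, the sum $\infty$ of all its elements is absorbing. $\beta$ factors through $\alpha$ if $\alpha(s)=\alpha(s')$ implies $\beta(s)=\beta(s')$ for forests $s,s'$. Wreath product: $(H_1,V_1)\circ(H_2,V_2)=(H_1\times H_2,V_1\times V_2^{H_1})$, componentwise addition, $(v,f)(h_1,h_2)=(vh_1,f(h_1)h_2)$. For $\alpha:A^{\Delta}\to(H_1,V_1)$, $\beta:(A\times H_1)^{\Delta}\to(H_2,V_2)$, $\alpha\otimes\beta(a)=(\alpha(a),h\mapsto\beta(a,h))$; then $\alpha\otimes\beta(s)=(\alpha(s),\beta(s^{\alpha}))$ where $s^{\alpha}$ relabels each node whose subtree is $at$ by $(a,\alpha(t))$. Iterated products $\beta_1\otimes\cdots\otimes\beta_k$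 with $\beta_i:(A\times H_1\times\cdots\times H_{i-1})^{\Delta}\to(H_i,V_i)$ are formed likewise. A homomorphism is 1-definite if the value of a forest depends only on the set of labels of its root nodes. ${\cal U}_1=(\{0,\infty\},\{1,0\})$, $1$ the identity, $0$ the constant map to $\infty$. An $(\mathsf{EF},\mathsf{EX})$-homomorphism is one that factors through some $\beta_1\otimes\cdots\otimes\beta_k$ where each $\beta_i$ maps into ${\cal U}_1$ or is 1-definite. Reachability: $h\le h'$ iff $h=vh'$ for some $v\in V$; reachability classes are the classes of $h\cong h'$ (both $h\le h'$ and $h'\le h$), partially ordered by $\le$; $h>\Gamma$ means the class of $h$ is strictly above $\Gamma$. For a class $\Gamma$, let $I_\Gamma=\{h\in H:h\not>\Gamma\}$ and let $\alpha_\Gamma:A^{\Delta}\to(H_\Gamma,V_\Gamma)$ be the quotient of $\alpha$ in which all elements of $I_\Gamma$ are identified to a single (absorbing) element $\infty$ (forests $s,s'$ identified iff $\alpha(s)=\alpha(s')\notin I_\Gamma$ or $\alpha(s),\alpha(s')\in I_\Gamma$). For any finite alphabet $B$, equivalences $\sim_k$ on $H_B$: $\sim_0$ identifies all forests; for $s=b_1s_1+\cdots+b_rs_r$, let $T^{k+1}_s=\{(b_i,[s_i]_{\sim_k}):1\le i\le r\}$ and $s\sim_{k+1}s'$ iff $T^{k+1}_s=T^{k+1}_{s'}$. For $k>0$ and a reachability class $\Gamma$, forests $s_1,s_2\in H_A$ satisfy $s_1\equiv_{\alpha,k,\Gamma}s_2$ if $(s_1)^{\alpha_\Gamma}\sim_k(s_2)^{\alpha_\Gamma}$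 (as forests over $A\times H_\Gamma$) and $\alpha(s_1),\alpha(s_2)\in\Gamma$. $\alpha$ is nonconfusing (with parameter $k$) if there is $k>0$ such that for every reachability class $\Gamma$, $s_1\equiv_{\alpha,k,\Gamma}s_2$ implies $\alpha(s_1)=\alpha(s_2)$.
   Formalization: The homomorphism α is additionally assumed surjective onto (H,V) (every h and every v is the image of a forest, resp. context); otherwise the claim fails, e.g. for "contains a" mapped into ({0,∞}, all maps), which is an (EF,EX)-homomorphism but confusing. *)

theory Defs
  imports Main
begin

datatype 'a tree = Node 'a "'a tree list"

type_synonym 'a forest = "'a tree list"

fun root :: "'a tree \<Rightarrow> 'a" where
  "root (Node a s) = a"

fun kids :: "'a tree \<Rightarrow> 'a forest" where
  "kids (Node a s) = s"

datatype 'a ctx = CHole "'a forest" "'a forest"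
  | CNode "'a forest" 'a "'a ctx" "'a forest"

fun fill :: "'a ctx \<Rightarrow> 'a forest \<Rightarrow> 'a forest" where
  "fill (CHole l r) t = l @ t @ r"
| "fill (CNode l a c r) t = l @ [Node a (fill c t)] @ r"

text \<open>A forest algebra \<open>(H,V)\<close>: \<open>H\<close> a monoid (carrier \<open>H\<close>, operation \<open>add\<close>, unit \<open>zero\<close>),
  \<open>V\<close> a monoid of transformations of \<open>H\<close> (faithful action; two functions are regarded
  as the same element of \<open>V\<close> when they agree on \<open>H\<close>), containing all translations.\<close>

definition forest_algebra ::
  "'h set \<Rightarrow> ('h \<Rightarrow> 'h \<Rightarrow> 'h) \<Rightarrow> 'h \<Rightarrow> ('h \<Rightarrow> 'h) set \<Rightarrow> bool" where
  "forest_algebra H add zero V \<longleftrightarrow>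
     zero \<in> H \<and>
     (\<forall>g\<in>H. \<forall>h\<in>H. add g h \<in> H) \<and>
     (\<forall>f\<in>H. \<forall>g\<in>H. \<forall>h\<in>H. add (add f g) h = add f (add g h)) \<and>
     (\<forall>h\<in>H. add zero h = h \<and> add h zero = h) \<and>
     (\<forall>v\<in>V. \<forall>h\<in>H. v h \<in> H) \<and>
     (\<exists>v\<in>V. \<forall>h\<in>H. v h = h) \<and>
     (\<forall>v\<in>V. \<forall>w\<in>V. v \<circ> w \<in> V) \<and>
     (\<forall>h\<in>H. (\<exists>v\<in>V. \<forall>g\<in>H. v g = add g h) \<and> (\<exists>v\<in>V. \<forall>g\<in>H. v g = add h g))"

text \<open>A homomorphism from the free forest algebra \<open>A\<^sup>\<Delta>\<close>, given by its action on forests;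
  it is determined by the images \<open>f a\<close> of the contexts \<open>a[]\<close>.\<close>

definition forest_hom ::
  "'h set \<Rightarrow> ('h \<Rightarrow> 'h \<Rightarrow> 'h) \<Rightarrow> 'h \<Rightarrow> ('h \<Rightarrow> 'h) set \<Rightarrow> ('a forest \<Rightarrow> 'h) \<Rightarrow> bool" where
  "forest_hom H add zero V \<alpha> \<longleftrightarrow>
     forest_algebra H add zero V \<and>
     (\<forall>s. \<alpha> s \<in> H) \<and>
     \<alpha> [] = zero \<and>
     (\<forall>s t. \<alpha> (s @ t) = add (\<alpha> s) (\<alpha> t)) \<and>
     (\<exists>f. (\<forall>a. f a \<in> V) \<and> (\<forall>a s. \<alpha> [Node a s] = f a (\<alpha> s)))"

definition forest_hom_surj ::
  "'h set \<Rightarrow> ('h \<Rightarrow> 'h) set \<Rightarrow> ('a forest \<Rightarrow> 'h) \<Rightarrow> bool" where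
  "forest_hom_surj H V \<alpha> \<longleftrightarrow>
     H \<subseteq> range \<alpha> \<and> (\<forall>v\<in>V. \<exists>c. \<forall>t. v (\<alpha> t) = \<alpha> (fill c t))"

fun relabel_tree :: "('a forest \<Rightarrow> 'v) \<Rightarrow> 'a tree \<Rightarrow> ('a \<times> 'v) tree" where
  "relabel_tree f (Node a s) = Node (a, f s) (map (relabel_tree f) s)"

definition relabel :: "('a forest \<Rightarrow> 'v) \<Rightarrow> 'a forest \<Rightarrow> ('a \<times> 'v) forest" where
  "relabel f s = map (relabel_tree f) s"

text \<open>The forest algebra \<open>U\<^sub>1\<close>, encoded over \<open>nat\<close>: \<open>0\<close> is the element \<open>0\<close>, \<open>1\<close> is \<open>infty\<close>;
  the identity is \<open>id\<close>, the constant map to \<open>infty\<close> is \<open>\<lambda>g. max g 1\<close> (constant on \<open>H\<close>).\<close>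

definition U1_hom :: "('b forest \<Rightarrow> nat) \<Rightarrow> bool" where
  "U1_hom \<beta> \<longleftrightarrow> forest_hom {0, 1} max 0 {id, \<lambda>g. max g 1} \<beta>"

text \<open>A 1-definite homomorphism (into some forest algebra; the carrier is taken inside \<open>nat\<close>,
  which loses nothing since one may always pass to the countable image subalgebra).\<close>

definition one_definite_hom :: "('b forest \<Rightarrow> nat) \<Rightarrow> bool" where
  "one_definite_hom \<beta> \<longleftrightarrow>
     (\<exists>H add zero V. forest_hom H add zero V \<beta>) \<and>
     (\<forall>s s'. set (map root s) = set (map root s') \<longrightarrow> \<beta> s = \<beta> s')"

text \<open>Iterated wreath product \<open>\<beta>\<^sub>1 x \<dots> x \<beta>\<^sub>k\<close> on forests.  The layer \<open>\<beta>\<^sub>i\<close> reads forests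
  over \<open>A \<times> H\<^sub>1 \<times> \<dots> \<times> H\<^sub>i\<^sub>-\<^sub>1\<close>, the tuple of previous values being a list.
  \<open>casc_rev\<close> takes the layers in reverse order (last layer first).\<close>

primrec casc_rev :: "((('a \<times> nat list) forest \<Rightarrow> nat)) list \<Rightarrow> 'a forest \<Rightarrow> nat list" where
  "casc_rev [] = (\<lambda>t. [])"
| "casc_rev (b # bs) = (\<lambda>t. casc_rev bs t @ [b (relabel (casc_rev bs) t)])"

definition cascade :: "((('a \<times> nat list) forest \<Rightarrow> nat)) list \<Rightarrow> 'a forest \<Rightarrow> nat list" where
  "cascade bs = casc_rev (rev bs)"

definition factors_through :: "('a forest \<Rightarrow> 'h) \<Rightarrow> ('a forest \<Rightarrow> 'k) \<Rightarrow> bool" where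
  "factors_through \<beta> \<alpha> \<longleftrightarrow> (\<forall>s s'. \<alpha> s = \<alpha> s' \<longrightarrow> \<beta> s = \<beta> s')"

definition EF_EX_hom :: "('a forest \<Rightarrow> 'h) \<Rightarrow> bool" where
  "EF_EX_hom \<alpha> \<longleftrightarrow>
     (\<exists>bs. (\<forall>b\<in>set bs. U1_hom b \<or> one_definite_hom b) \<and> factors_through \<alpha> (cascade bs))"

definition reach :: "('h \<Rightarrow> 'h) set \<Rightarrow> 'h \<Rightarrow> 'h \<Rightarrow> bool" where
  "reach V h h' \<longleftrightarrow> (\<exists>v\<in>V. h = v h')"

definition reach_classes :: "'h set \<Rightarrow> ('h \<Rightarrow> 'h) set \<Rightarrow> 'h set set" where
  "reach_classes H V = {{h' \<in> H. reach V h h' \<and> reach V h' h} | h. h \<in> H}"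

definition above :: "('h \<Rightarrow> 'h) set \<Rightarrow> 'h \<Rightarrow> 'h set \<Rightarrow> bool" where
  "above V h \<Gamma> \<longleftrightarrow> (\<exists>g\<in>\<Gamma>. reach V g h \<and> \<not> reach V h g)"

definition I_set :: "'h set \<Rightarrow> ('h \<Rightarrow> 'h) set \<Rightarrow> 'h set \<Rightarrow> 'h set" where
  "I_set H V \<Gamma> = {h \<in> H. \<not> above V h \<Gamma>}"

text \<open>\<open>\<alpha>\<^sub>\<Gamma>\<close>: the elements of \<open>I\<^sub>\<Gamma>\<close> are collapsed to \<open>None\<close> (playing the role of \<open>infty\<close>).\<close>

definition alpha_Gamma ::
  "'h set \<Rightarrow> ('h \<Rightarrow> 'h) set \<Rightarrow> 'h set \<Rightarrow> ('a forest \<Rightarrow> 'h) \<Rightarrow> 'a forest \<Rightarrow> 'h option" where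
  "alpha_Gamma H V \<Gamma> \<alpha> s = (if \<alpha> s \<in> I_set H V \<Gamma> then None else Some (\<alpha> s))"

fun sim_k :: "nat \<Rightarrow> 'b forest \<Rightarrow> 'b forest \<Rightarrow> bool" where
  "sim_k 0 s s' = True"
| "sim_k (Suc k) s s' =
     ((\<lambda>t. (root t, {u. sim_k k (kids t) u})) ` set s =
      (\<lambda>t. (root t, {u. sim_k k (kids t) u})) ` set s')"

definition equiv_akG ::
  "'h set \<Rightarrow> ('h \<Rightarrow> 'h) set \<Rightarrow> ('a forest \<Rightarrow> 'h) \<Rightarrow> nat \<Rightarrow> 'h set \<Rightarrow> 'a forest \<Rightarrow> 'a forest \<Rightarrow> bool" where
  "equiv_akG H V \<alpha> k \<Gamma> s1 s2 \<longleftrightarrow>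
     sim_k k (relabel (alpha_Gamma H V \<Gamma> \<alpha>) s1) (relabel (alpha_Gamma H V \<Gamma> \<alpha>) s2) \<and>
     \<alpha> s1 \<in> \<Gamma> \<and> \<alpha> s2 \<in> \<Gamma>"

definition nonconfusing :: "'h set \<Rightarrow> ('h \<Rightarrow> 'h) set \<Rightarrow> ('a forest \<Rightarrow> 'h) \<Rightarrow> bool" where
  "nonconfusing H V \<alpha> \<longleftrightarrow>
     (\<exists>k>0. \<forall>\<Gamma>\<in>reach_classes H V. \<forall>s1 s2.
        equiv_akG H V \<alpha> k \<Gamma> s1 s2 \<longrightarrow> \<alpha> s1 = \<alpha> s2)"

end

theory Submission
  imports Defs "HOL-Library.Countable" "HOL-Library.Nat_Bijection"
begin

text \<open>
  If \<open>\<alpha>\<close> factors through a cascade with \<open>n\<close> layers, then it is nonconfusing with \<open>k = n + 1\<close>.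
  The value of a \<open>U\<^sub>1\<close> layer can only grow when a context is applied, so every class \<open>\<Gamma>\<close> contains
  the value of some forest \<open>u\<close> at which all \<open>U\<^sub>1\<close> layers have stabilised, as long as one stays in \<open>\<Gamma>\<close>.
  Given \<open>s\<^sub>1\<close>, \<open>s\<^sub>2\<close> that are equivalent to depth \<open>k\<close>, replace the subforests with value above \<open>\<Gamma>\<close>
  by fixed representatives, and the subforests with value in \<open>\<Gamma>\<close> at depth \<open>k\<close> by forests with the
  same value that contain \<open>u\<close>. The cascade cannot distinguish the results: a \<open>U\<^sub>1\<close> layer is
  constant on forests in \<open>\<Gamma>\<close> containing \<open>u\<close>, a 1-definite layer looks one level deeper, and
  forests in which no replacement at depth \<open>k\<close> took place agree up to order and multiplicity.

  Conversely, the classes are added one at a time, from the top, to the set of values of \<open>\<alpha>\<close>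
  computed by a cascade.
\<close>

section \<open>Forests and contexts\<close>

lemma forest_induct [case_names forest]:
  assumes "\<And>s. (\<And>t. t \<in> set s \<Longrightarrow> P (kids t)) \<Longrightarrow> P s"
  shows "P s"
proof -
  have "P (kids t)" for t :: "'a tree"
    by (induction t) (simp add: assms)
  from this[of "Node undefined s"] show ?thesis by simp
qed

lemma Node_root_kids [simp]: "Node (root t) (kids t) = t"
  by (cases t) simp

lemma root_relabel_tree [simp]: "root (relabel_tree f t) = (root t, f (kids t))"
  by (cases t) simp

lemma kids_relabel_tree [simp]: "kids (relabel_tree f t) = relabel f (kids t)"
  by (cases t) (simp add: relabel_def)

lemma relabel_tree_eq: "relabel_tree f t = Node (root t, f (kids t)) (relabel f (kids t))"
  by (cases t) (simp add: relabel_def)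

lemma relabel_Node: "relabel f [Node a s] = [Node (a, f s) (relabel f s)]"
  by (simp add: relabel_def)

lemma relabel_append: "relabel f (s @ t) = relabel f s @ relabel f t"
  by (simp add: relabel_def)

lemma fill_fill: "\<exists>e. \<forall>t. fill d (fill c t) = fill e t"
proof (induction d)
  case (CHole l r)
  show ?case
  proof (cases c)
    case (CHole l' r')
    then have "\<forall>t. fill (CHole l r) (fill c t) = fill (CHole (l @ l') (r' @ r)) t" by simp
    then show ?thesis by blast
  next
    case (CNode l' a c' r')
    then have "\<forall>t. fill (CHole l r) (fill c t) = fill (CNode (l @ l') a c' (r' @ r)) t" by simp
    then show ?thesis by blast
  qed
next
  case (CNode l a d r)
  then obtain e where "\<forall>t. fill d (fill c t) = fill e t" by blast
  then have "\<forall>t. fill (CNode l a d r) (fill c t) = fill (CNode l a e r) t" by simp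
  then show ?case by blast
qed

lemma fill_kids:
  assumes "t \<in> set s"
  obtains c where "s = fill c (kids t)"
proof -
  obtain l r where "s = l @ t # r" using assms by (meson split_list)
  then have "s = fill (CNode l (root t) (CHole [] []) r) (kids t)" by simp
  then show ?thesis by (rule that)
qed

section \<open>The equivalences \<open>sim_k\<close>\<close>

lemma sim_k_refl: "sim_k k s s"
  by (cases k) auto

lemma sim_k_sym: "sim_k k s s' \<Longrightarrow> sim_k k s' s"
  by (cases k) auto

lemma sim_k_trans: "sim_k k s t \<Longrightarrow> sim_k k t u \<Longrightarrow> sim_k k s u"
  by (cases k) auto

lemma sim_k_class_eq_iff: "{u. sim_k k s u} = {u. sim_k k s' u} \<longleftrightarrow> sim_k k s s'"
  by (blast intro: sim_k_refl sim_k_sym sim_k_trans)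

text \<open>Turns equality of sets of node data into a two-way matching of trees, the common form in
  which \<open>sim_k\<close>, 1-definite layers and \<open>roots_layer\<close> are compared.\<close>

lemma image_eq_image_iff_rel_set: "f ` A = f ` B \<longleftrightarrow> rel_set (\<lambda>x y. f x = f y) A B"
  unfolding rel_set_def set_eq_iff image_iff by metis

lemma sim_k_Suc_relabel:
  "sim_k (Suc k) (relabel f s) (relabel f s') \<longleftrightarrow>
     rel_set (\<lambda>t t'. root t = root t' \<and> f (kids t) = f (kids t') \<and>
       sim_k k (relabel f (kids t)) (relabel f (kids t'))) (set s) (set s')"
  by (simp add: relabel_def[of f s] relabel_def[of f s'] image_image
      image_eq_image_iff_rel_set sim_k_class_eq_iff conj_assoc)

section \<open>The layers of a cascade\<close>

abbreviation EF_EX_layer :: "('b forest \<Rightarrow> nat) \<Rightarrow> bool" where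
  "EF_EX_layer b \<equiv> U1_hom b \<or> one_definite_hom b"

lemma U1_hom_Nil: "U1_hom b \<Longrightarrow> b [] = 0"
  and U1_hom_append: "U1_hom b \<Longrightarrow> b (s @ t) = max (b s) (b t)"
  and U1_hom_01: "U1_hom b \<Longrightarrow> b s = 0 \<or> b s = 1"
  unfolding U1_hom_def forest_hom_def by auto

lemma U1_hom_Node:
  assumes "U1_hom b"
  obtains f where "\<And>a. f a \<in> {id, \<lambda>g. max g 1}" and "\<And>a s. b [Node a s] = f a (b s)"
  using assms unfolding U1_hom_def forest_hom_def by blast

lemma U1_hom_Node_ge:
  assumes "U1_hom b"
  shows "b s \<le> b [Node a s]"
proof -
  obtain f where f: "\<And>a. f a \<in> {id, \<lambda>g. max g 1}" "\<And>a s. b [Node a s] = f a (b s)"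
    using U1_hom_Node[OF assms] by blast
  from f(1)[of a] show ?thesis by (auto simp: f(2))
qed

lemma U1_hom_eq_1_iff:
  assumes "U1_hom b"
  shows "b s = 1 \<longleftrightarrow> (\<exists>t\<in>set s. b [t] = 1)"
proof (induction s)
  case Nil
  then show ?case using U1_hom_Nil[OF assms] by simp
next
  case (Cons t s)
  have "b (t # s) = max (b [t]) (b s)" using U1_hom_append[OF assms, of "[t]" s] by simp
  then show ?case using Cons U1_hom_01[OF assms, of "[t]"] U1_hom_01[OF assms, of s]
    by (auto simp: max_def)
qed

lemma U1_hom_fill_mono:
  assumes "U1_hom b"
  shows "b (relabel g t) \<le> b (relabel g (fill c t))"
proof (induction c)
  case (CHole l r)
  then show ?case by (simp add: relabel_append U1_hom_append[OF assms])
next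
  case (CNode l a c r)
  have "b (relabel g (fill c t)) \<le> b (relabel g [Node a (fill c t)])"
    unfolding relabel_Node by (rule U1_hom_Node_ge[OF assms])
  then have "b (relabel g t) \<le> b (relabel g [Node a (fill c t)])" using CNode by linarith
  moreover have "b (relabel g [Node a (fill c t)]) \<le> b (relabel g (l @ [Node a (fill c t)] @ r))"
    unfolding relabel_append U1_hom_append[OF assms] by simp
  ultimately show ?case by simp
qed

lemma one_definite_homD:
  "one_definite_hom b \<Longrightarrow> root ` set s = root ` set s' \<Longrightarrow> b s = b s'"
  unfolding one_definite_hom_def set_map by blast

lemma one_definite_relabel_cong:
  assumes "one_definite_hom b"
    and "rel_set (\<lambda>t t'. root t = root t' \<and> f (kids t) = f (kids t')) (set s) (set s')"
  shows "b (relabel f s) = b (relabel f s')"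
proof (rule one_definite_homD[OF assms(1)])
  show "root ` set (relabel f s) = root ` set (relabel f s')"
    using assms(2) by (simp add: relabel_def image_image image_eq_image_iff_rel_set)
qed

section \<open>Cascade values and matchings of trees\<close>

lemma casc_rev_Cons_eq_iff:
  "casc_rev (b # bs) s = casc_rev (b # bs) s' \<longleftrightarrow>
     casc_rev bs s = casc_rev bs s' \<and>
     b (relabel (casc_rev bs) s) = b (relabel (casc_rev bs) s')"
  by simp

text \<open>A 1-definite layer sees only the set of relabelled roots. A \<open>U1_hom\<close> layer
  is 1 on a forest iff it is 1 on one of its trees, and its value on a tree depends on the
  relabelled root and its value on the children. So order and multiplicity of trees do not
  matter.\<close>

lemma casc_rev_cong:
  assumes "\<forall>b\<in>set bs. EF_EX_layer b"
    and "rel_set (\<lambda>t t'. root t = root t' \<and> casc_rev bs (kids t) = casc_rev bs (kids t'))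
           (set s) (set s')"
  shows "casc_rev bs s = casc_rev bs s'"
  using assms
proof (induction bs)
  case Nil
  then show ?case by simp
next
  case (Cons b bs)
  let ?R = "\<lambda>t t'. root t = root t' \<and> casc_rev bs (kids t) = casc_rev bs (kids t')"
  have R: "rel_set ?R (set s) (set s')"
    using Cons.prems(2) unfolding casc_rev_Cons_eq_iff rel_set_def by blast
  then have "casc_rev bs s = casc_rev bs s'" using Cons by simp
  moreover have "b (relabel (casc_rev bs) s) = b (relabel (casc_rev bs) s')"
  proof (cases "one_definite_hom b")
    case True
    then show ?thesis using R by (rule one_definite_relabel_cong)
  next
    case False
    then have U: "U1_hom b" using Cons.prems(1) by simp
    obtain f where "\<And>a. f a \<in> {id, \<lambda>g. max g 1}" and f: "\<And>a s. b [Node a s] = f a (b s)"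
      using U1_hom_Node[OF U] by blast
    have tree: "b [relabel_tree (casc_rev bs) t] = b [relabel_tree (casc_rev bs) t']"
      if "root t = root t'" "casc_rev (b # bs) (kids t) = casc_rev (b # bs) (kids t')" for t t'
    proof -
      have "b [relabel_tree (casc_rev bs) t] =
          f (root t, casc_rev bs (kids t)) (b (relabel (casc_rev bs) (kids t)))" for t
        unfolding relabel_tree_eq[of _ t] by (rule f)
      then show ?thesis using that by simp
    qed
    have eq_1: "b (relabel (casc_rev bs) s) = 1 \<longleftrightarrow> (\<exists>t\<in>set s. b [relabel_tree (casc_rev bs) t] = 1)"
      for s by (subst U1_hom_eq_1_iff[OF U]) (simp add: relabel_def)
    have "b (relabel (casc_rev bs) s) = 1 \<longleftrightarrow> b (relabel (casc_rev bs) s') = 1"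
      unfolding eq_1 using Cons.prems(2) tree unfolding rel_set_def by metis
    then show ?thesis using U1_hom_01[OF U] by metis
  qed
  ultimately show ?case by simp
qed

text \<open>The finest 1-definite map, coded as a number because layers take values in
  \<open>nat\<close>.\<close>

definition roots_layer :: "'b::countable forest \<Rightarrow> nat" where
  "roots_layer s = set_encode (to_nat ` root ` set s)"

lemma roots_layer_eq_iff: "roots_layer s = roots_layer s' \<longleftrightarrow> root ` set s = root ` set s'"
  unfolding roots_layer_def by (simp add: set_encode_eq inj_image_eq_iff)

lemma one_definite_roots_layer: "one_definite_hom (roots_layer :: 'b::countable forest \<Rightarrow> nat)"
  unfolding one_definite_hom_def
proof (intro conjI exI allI impI)
  let ?add = "\<lambda>m n. set_encode (set_decode m \<union> set_decode n)"
  show "forest_hom UNIV ?add 0 UNIV (roots_layer :: 'b forest \<Rightarrow> nat)"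
    unfolding forest_hom_def
  proof (intro conjI)
    show "forest_algebra UNIV ?add 0 UNIV"
      unfolding forest_algebra_def by (auto simp: Un_assoc)
    show "\<exists>f. (\<forall>a. f a \<in> UNIV) \<and>
        (\<forall>a s. (roots_layer :: 'b forest \<Rightarrow> nat) [Node a s] = f a (roots_layer s))"
      by (rule exI[of _ "\<lambda>a _. set_encode {to_nat a}"]) (simp add: roots_layer_def)
  qed (auto simp: roots_layer_def image_Un)
qed (simp add: roots_layer_eq_iff)

text \<open>Putting a root layer on top of \<open>bs\<close> makes one more level of depth
  visible.\<close>

lemma casc_rev_roots_layer_eq_iff:
  "casc_rev (roots_layer # bs) s = casc_rev (roots_layer # bs) s' \<longleftrightarrow>
     casc_rev bs s = casc_rev bs s' \<and>
     rel_set (\<lambda>t t'. root t = root t' \<and> casc_rev bs (kids t) = casc_rev bs (kids t'))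
       (set s) (set s')"
  by (simp add: roots_layer_eq_iff relabel_def image_image image_eq_image_iff_rel_set)

lemma casc_rev_replicate_roots_layer:
  "casc_rev (replicate k roots_layer @ bs) s = casc_rev (replicate k roots_layer @ bs) s' \<Longrightarrow>
   casc_rev bs s = casc_rev bs s'"
  by (induction k) auto

text \<open>Each root layer exposes one level, and \<open>bs\<close> determines \<open>f\<close>; so
  \<open>k\<close> root layers reveal the relabelling by \<open>f\<close> to depth \<open>k\<close>.
  Used with \<open>f\<close> the quotient map of a class.\<close>

lemma sim_k_if_casc_rev_eq:
  assumes "\<And>s s'. casc_rev bs s = casc_rev bs s' \<Longrightarrow> f s = f s'"
    and "casc_rev (replicate k roots_layer @ bs) s = casc_rev (replicate k roots_layer @ bs) s'"
  shows "sim_k k (relabel f s) (relabel f s')"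
  using assms(2)
proof (induction k arbitrary: s s')
  case 0
  then show ?case by simp
next
  case (Suc k)
  let ?g = "casc_rev (replicate k roots_layer @ bs)"
  have R: "rel_set (\<lambda>t t'. root t = root t' \<and> ?g (kids t) = ?g (kids t')) (set s) (set s')"
    using Suc.prems unfolding replicate_Suc append_Cons casc_rev_roots_layer_eq_iff by blast
  have "f (kids t) = f (kids t')" "sim_k k (relabel f (kids t)) (relabel f (kids t'))"
    if "?g (kids t) = ?g (kids t')" for t t'
    using that casc_rev_replicate_roots_layer assms(1) Suc.IH by blast+
  with R show ?case unfolding sim_k_Suc_relabel rel_set_def by metis
qed

fun has_label :: "'b set \<Rightarrow> 'b tree \<Rightarrow> bool" where
  "has_label B (Node a s) \<longleftrightarrow> a \<in> B \<or> (\<exists>t\<in>set s. has_label B t)"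

definition label_layer :: "'b set \<Rightarrow> 'b forest \<Rightarrow> nat" where
  "label_layer B s = (if \<exists>t\<in>set s. has_label B t then 1 else 0)"

lemma has_label_iff: "has_label B t \<longleftrightarrow> root t \<in> B \<or> (\<exists>u\<in>set (kids t). has_label B u)"
  by (cases t) simp

lemma U1_label_layer: "U1_hom (label_layer B)"
  unfolding U1_hom_def forest_hom_def
proof (intro conjI)
  show "forest_algebra {0, 1} max 0 {id, \<lambda>g::nat. max g 1}"
    unfolding forest_algebra_def by (auto simp: fun_eq_iff max.assoc)
  show "\<exists>f. (\<forall>a. f a \<in> {id, \<lambda>g::nat. max g 1}) \<and>
      (\<forall>a s. label_layer B [Node a s] = f a (label_layer B s))"
    by (rule exI[of _ "\<lambda>a. if a \<in> B then (\<lambda>g. max g 1) else id"]) (auto simp: label_layer_def)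
qed (auto simp: label_layer_def)

section \<open>Reachability\<close>

locale surj_forest_hom =
  fixes H :: "'h set" and add :: "'h \<Rightarrow> 'h \<Rightarrow> 'h" and zero :: 'h
    and V :: "('h \<Rightarrow> 'h) set" and \<alpha> :: "'a forest \<Rightarrow> 'h"
  assumes hom: "forest_hom H add zero V \<alpha>"
    and surj: "forest_hom_surj H V \<alpha>"
begin

lemma algebra: "forest_algebra H add zero V"
  using hom unfolding forest_hom_def by simp

lemma alpha_in: "\<alpha> s \<in> H"
  using hom unfolding forest_hom_def by simp

lemma alpha_append: "\<alpha> (s @ t) = add (\<alpha> s) (\<alpha> t)"
  using hom unfolding forest_hom_def by simp

lemma alpha_Node:
  obtains f where "\<And>a. f a \<in> V" and "\<And>a s. \<alpha> [Node a s] = f a (\<alpha> s)"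
  using hom unfolding forest_hom_def by blast

lemma alpha_Node_cong: "\<alpha> s = \<alpha> s' \<Longrightarrow> \<alpha> [Node a s] = \<alpha> [Node a s']"
  by (metis alpha_Node)

lemma alpha_tree_cong:
  "root t = root t' \<Longrightarrow> \<alpha> (kids t) = \<alpha> (kids t') \<Longrightarrow> \<alpha> [t] = \<alpha> [t']"
  by (metis alpha_Node_cong Node_root_kids)

lemma alpha_map_cong: "(\<And>t. t \<in> set s \<Longrightarrow> \<alpha> [f t] = \<alpha> [t]) \<Longrightarrow> \<alpha> (map f s) = \<alpha> s"
proof (induction s)
  case (Cons t s)
  then show ?case using alpha_append[of "[f t]" "map f s"] alpha_append[of "[t]" s] by simp
qed simp

lemma reach_refl: "h \<in> H \<Longrightarrow> reach V h h"
  using algebra unfolding forest_algebra_def reach_def by metis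

lemma reach_trans: "reach V f g \<Longrightarrow> reach V g h \<Longrightarrow> reach V f h"
  using algebra unfolding forest_algebra_def reach_def by (metis comp_apply)

lemma reach_add_right: "g \<in> H \<Longrightarrow> h \<in> H \<Longrightarrow> reach V (add g h) g"
  using algebra unfolding forest_algebra_def reach_def by metis

lemma reach_add_left: "g \<in> H \<Longrightarrow> h \<in> H \<Longrightarrow> reach V (add g h) h"
  using algebra unfolding forest_algebra_def reach_def by metis

lemma reach_append: "reach V (\<alpha> (l @ t @ r)) (\<alpha> t)"
  using reach_add_left[of "\<alpha> l" "\<alpha> (t @ r)"] reach_add_right[of "\<alpha> t" "\<alpha> r"]
  by (auto simp: alpha_append alpha_in intro: reach_trans alpha_in[of "t @ r", unfolded alpha_append])

lemma reach_Node: "reach V (\<alpha> [Node a s]) (\<alpha> s)"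
  using alpha_Node unfolding reach_def by metis

lemma reach_fill: "reach V (\<alpha> (fill c t)) (\<alpha> t)"
proof (induction c)
  case (CHole l r)
  then show ?case using reach_append by simp
next
  case (CNode l a c r)
  then show ?case
    using reach_append[of l "[Node a (fill c t)]" r] reach_Node[of a "fill c t"]
    by (auto intro: reach_trans)
qed

lemma reach_kids: "t \<in> set s \<Longrightarrow> reach V (\<alpha> s) (\<alpha> (kids t))"
  by (metis fill_kids reach_fill)

lemma reach_obtain_fill:
  assumes "reach V h (\<alpha> t)"
  obtains c where "\<alpha> (fill c t) = h"
  using assms surj unfolding reach_def forest_hom_surj_def by metis

lemma alpha_inv: "h \<in> H \<Longrightarrow> \<alpha> (inv \<alpha> h) = h"
  using surj unfolding forest_hom_surj_def by (simp add: f_inv_into_f subset_iff)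

definition reach_class :: "'h \<Rightarrow> 'h set" where
  "reach_class g = {h \<in> H. reach V g h \<and> reach V h g}"

lemma reach_classes_eq: "reach_classes H V = reach_class ` H"
  unfolding reach_classes_def reach_class_def by blast

lemma above_reach_class:
  "g \<in> H \<Longrightarrow> above V h (reach_class g) \<longleftrightarrow> reach V g h \<and> \<not> reach V h g"
  unfolding above_def reach_class_def by (auto intro: reach_refl reach_trans)

abbreviation quot :: "'h \<Rightarrow> 'a forest \<Rightarrow> 'h option" where
  "quot g \<equiv> alpha_Gamma H V (reach_class g) \<alpha>"

lemma quot_eq:
  "g \<in> H \<Longrightarrow> quot g s = (if reach V g (\<alpha> s) \<and> \<not> reach V (\<alpha> s) g then Some (\<alpha> s) else None)"
  unfolding alpha_Gamma_def I_set_def by (simp add: alpha_in above_reach_class)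

section \<open>\<open>(EF,EX)\<close>-homomorphisms are nonconfusing\<close>

text \<open>Recursion on the list, since \<open>b\<close> reads forests relabelled by the layers
  \<open>bs\<close> below it. Only contexts that keep the value in \<Gamma> are considered.\<close>

primrec stable :: "'h set \<Rightarrow> (('a \<times> nat list) forest \<Rightarrow> nat) list \<Rightarrow> 'a forest \<Rightarrow> bool" where
  "stable \<Gamma> [] u \<longleftrightarrow> \<alpha> u \<in> \<Gamma>"
| "stable \<Gamma> (b # bs) u \<longleftrightarrow> stable \<Gamma> bs u \<and> (U1_hom b \<longrightarrow>
     (\<forall>c. \<alpha> (fill c u) \<in> \<Gamma> \<longrightarrow>
        b (relabel (casc_rev bs) (fill c u)) = b (relabel (casc_rev bs) u)))"

lemma stable_in: "stable \<Gamma> bs u \<Longrightarrow> \<alpha> u \<in> \<Gamma>"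
  by (induction bs) auto

lemma stable_fill: "stable \<Gamma> bs u \<Longrightarrow> \<alpha> (fill c u) \<in> \<Gamma> \<Longrightarrow> stable \<Gamma> bs (fill c u)"
proof (induction bs)
  case (Cons b bs)
  then show ?case using fill_fill by (metis stable.simps(2))
qed simp

text \<open>The layers are stabilised one after another, lowest first. Moving to a larger forest
  within \<Gamma> keeps the earlier layers stable by \<open>stable_fill\<close>.\<close>

lemma stable_exists:
  assumes "\<alpha> u \<in> \<Gamma>"
  shows "\<exists>u. stable \<Gamma> bs u"
proof (induction bs)
  case Nil
  then show ?case using assms by auto
next
  case (Cons b bs)
  then obtain u where u: "stable \<Gamma> bs u" by blast
  let ?b = "\<lambda>s. b (relabel (casc_rev bs) s)"
  show ?case
  \<comment> \<open>If the layer can still reach 1 inside \<Gamma>, move there: 1 persists under all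
    contexts. Otherwise its value is 0 throughout \<Gamma>, and by monotonicity also at
    \<open>u\<close>.\<close>
  proof (cases "U1_hom b \<and> (\<exists>c. \<alpha> (fill c u) \<in> \<Gamma> \<and> ?b (fill c u) = 1)")
    case True
    then obtain c where U: "U1_hom b" and c: "\<alpha> (fill c u) \<in> \<Gamma>" "?b (fill c u) = 1" by blast
    have "?b (fill d (fill c u)) = 1" for d
      using U1_hom_fill_mono[OF U, of "casc_rev bs" "fill c u" d] c(2)
        U1_hom_01[OF U, of "relabel (casc_rev bs) (fill d (fill c u))"] by auto
    then have "stable \<Gamma> (b # bs) (fill c u)" using c stable_fill[OF u c(1)] by simp
    then show ?thesis by blast
  next
    case False
    have "?b (fill c u) = ?b u" if "U1_hom b" "\<alpha> (fill c u) \<in> \<Gamma>" for c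
    proof -
      have "?b (fill c u) = 0" using False that U1_hom_01 by blast
      then show ?thesis using U1_hom_fill_mono[OF that(1), of "casc_rev bs" u c] by simp
    qed
    then have "stable \<Gamma> (b # bs) u" using u by simp
    then show ?thesis by blast
  qed
qed

end

text \<open>Below, \<open>P\<close> says that the value is strictly above \<Gamma>, \<open>T\<close>
  picks a representative of a value, and \<open>U\<close> replaces a forest in \<Gamma> by one of
  equal value containing the stable forest. \<open>U\<close> acts only where the depth budget runs
  out before \<open>P\<close> holds.\<close>

primrec trunc :: "('a forest \<Rightarrow> bool) \<Rightarrow> ('a forest \<Rightarrow> 'a forest) \<Rightarrow> ('a forest \<Rightarrow> 'a forest) \<Rightarrow>
    nat \<Rightarrow> 'a forest \<Rightarrow> 'a forest" where
  "trunc P T U 0 s = (if P s then T s else U s)"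
| "trunc P T U (Suc j) s =
     (if P s then T s else map (\<lambda>t. Node (root t) (trunc P T U j (kids t))) s)"

text \<open>Truncation at depth \<open>j\<close> never uses \<open>U\<close>.\<close>

primrec exhausted :: "('a forest \<Rightarrow> bool) \<Rightarrow> nat \<Rightarrow> 'a forest \<Rightarrow> bool" where
  "exhausted P 0 s \<longleftrightarrow> P s"
| "exhausted P (Suc j) s \<longleftrightarrow> P s \<or> (\<forall>t\<in>set s. exhausted P j (kids t))"

lemma exhausted_if: "P s \<Longrightarrow> exhausted P j s"
  by (cases j) auto

lemma rel_set_map_trunc:
  assumes "rel_set (\<lambda>t t'. root t = root t' \<and>
      f (trunc P T U j (kids t)) = f (trunc P T U j (kids t'))) (set s) (set s')"
    and "\<not> P s" "\<not> P s'"
  shows "rel_set (\<lambda>t t'. root t = root t' \<and> f (kids t) = f (kids t'))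
    (set (trunc P T U (Suc j) s)) (set (trunc P T U (Suc j) s'))"
  using assms by (simp add: rel_set_def)

context surj_forest_hom
begin

lemma nonconfusing_if_factors_through:
  assumes bs: "\<forall>b\<in>set bs. EF_EX_layer b"
    and fact: "factors_through \<alpha> (casc_rev bs)"
  shows "nonconfusing H V \<alpha>"
proof -
  \<comment> \<open>One level per layer is enough for \<open>main\<close>; \<open>Suc\<close> keeps
    the parameter positive for the empty cascade.\<close>
  have "\<alpha> s1 = \<alpha> s2"
    if g: "g \<in> H" and eq: "equiv_akG H V \<alpha> (Suc (length bs)) (reach_class g) s1 s2" for g s1 s2
  proof -
    define \<Gamma> where "\<Gamma> = reach_class g"
    obtain u where u: "stable \<Gamma> bs u"
      using stable_exists[of "inv \<alpha> g" \<Gamma>] g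
      by (metis (mono_tags, lifting) \<Gamma>_def alpha_inv mem_Collect_eq reach_class_def reach_refl)
    have \<Gamma>: "h \<in> \<Gamma> \<longleftrightarrow> h \<in> H \<and> reach V g h \<and> reach V h g" for h
      by (simp add: \<Gamma>_def reach_class_def)
    define P where "P s \<longleftrightarrow> reach V g (\<alpha> s) \<and> \<not> reach V (\<alpha> s) g" for s
    \<comment> \<open>\<open>T\<close> depends on the value alone, so forests of equal value above
      \<Gamma> become literally equal.\<close>
    define T where "T s = inv \<alpha> (\<alpha> s)" for s
    define U where "U s = (SOME t. \<alpha> t = \<alpha> s \<and> (\<exists>c. t = fill c u))" for s
    let ?N = "trunc P T U"
    have quot: "quot g s = (if P s then Some (\<alpha> s) else None)" for s
      using quot_eq[OF g] by (simp add: P_def)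
    have T: "\<alpha> (T s) = \<alpha> s" for s
      unfolding T_def by (rule alpha_inv[OF alpha_in])
    have U: "\<alpha> (U s) = \<alpha> s \<and> (\<exists>c. U s = fill c u)" if "reach V g (\<alpha> s)" "\<not> P s" for s
    proof -
      have "reach V (\<alpha> s) (\<alpha> u)"
        using that stable_in[OF u] \<Gamma> unfolding P_def by (blast intro: reach_trans)
      then obtain c where "\<alpha> (fill c u) = \<alpha> s" by (rule reach_obtain_fill)
      then have "\<exists>t. \<alpha> t = \<alpha> s \<and> (\<exists>c. t = fill c u)" by blast
      then show ?thesis unfolding U_def by (rule someI_ex)
    qed
    have good_kids: "reach V g (\<alpha> (kids t))" if "t \<in> set s" "reach V g (\<alpha> s)" for t s
      using reach_kids[OF that(1)] that(2) by (blast intro: reach_trans)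
    have N: "\<alpha> (?N j s) = \<alpha> s" if "reach V g (\<alpha> s)" for j s
      using that
    proof (induction j arbitrary: s)
      case 0
      then show ?case using T U by simp
    next
      case (Suc j)
      have "\<alpha> [Node (root t) (?N j (kids t))] = \<alpha> [t]" if "t \<in> set s" for t
        using Suc.IH[OF good_kids[OF that Suc.prems]] by (intro alpha_tree_cong) auto
      then show ?case using T by (auto intro: alpha_map_cong)
    qed
    \<comment> \<open>If the truncation is not exhausted, some branch ends in \<open>U\<close>,
      which leaves a copy of \<open>u\<close> inside the result.\<close>
    have N_fill: "\<exists>c. ?N j s = fill c u" if "reach V g (\<alpha> s)" "\<not> exhausted P j s" for j s
      using that
    proof (induction j arbitrary: s)
      case 0
      then show ?case using U by simp
    next
      case (Suc j)
      then obtain t where t: "t \<in> set s" "\<not> exhausted P j (kids t)" by auto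
      obtain c where c: "?N j (kids t) = fill c u" using Suc.IH good_kids t Suc.prems by blast
      have "Node (root t) (?N j (kids t)) \<in> set (?N (Suc j) s)" using t Suc.prems by auto
      then show ?case using c by (metis fill_kids fill_fill kids.simps)
    qed
    \<comment> \<open>Without uses of \<open>U\<close>, the result is fixed, up to order and
      multiplicity, by the labels and quotient values visible to depth \<open>j\<close>.
      \<open>casc_rev_cong\<close> then applies to any list of layers.\<close>
    have exh: "exhausted P j s' \<and> casc_rev bs' (?N j s) = casc_rev bs' (?N j s')"
      if "exhausted P j s" "\<forall>b\<in>set bs'. EF_EX_layer b" "quot g s = quot g s'"
        "sim_k j (relabel (quot g) s) (relabel (quot g) s')" for j s s' bs'
      using that
    proof (induction j arbitrary: s s')
      case 0
      then show ?case by (auto simp: quot T_def split: if_splits)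
    next
      case (Suc j)
      show ?case
      proof (cases "P s")
        case True
        then show ?thesis using Suc.prems(3) by (auto simp: quot T_def split: if_splits)
      next
        case False
        then have P: "\<not> P s" "\<not> P s'" using Suc.prems(3) by (auto simp: quot split: if_splits)
        have R: "rel_set (\<lambda>t t'. root t = root t' \<and> exhausted P j (kids t') \<and>
            casc_rev bs' (?N j (kids t)) = casc_rev bs' (?N j (kids t'))) (set s) (set s')"
          using Suc.prems(1,4) P(1) Suc.IH[OF _ Suc.prems(2)]
          unfolding sim_k_Suc_relabel rel_set_def exhausted.simps by metis
        have "casc_rev bs' (?N (Suc j) s) = casc_rev bs' (?N (Suc j) s')"
          by (intro casc_rev_cong rel_set_map_trunc P Suc.prems(2))
            (use R in \<open>auto simp: rel_set_def\<close>)
        moreover have "exhausted P (Suc j) s'" using R by (auto simp: rel_set_def)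
        ultimately show ?thesis by blast
      qed
    qed
    \<comment> \<open>Induction on the layers, with \<open>j\<close> and the forests arbitrary: only
      the 1-definite case descends to the children and lowers \<open>j\<close>.\<close>
    have main: "casc_rev bs' (?N j s) = casc_rev bs' (?N j s')"
      if "length bs' \<le> j" "\<forall>b\<in>set bs'. EF_EX_layer b" "stable \<Gamma> bs' u"
        "reach V g (\<alpha> s)" "reach V g (\<alpha> s')" "quot g s = quot g s'"
        "sim_k j (relabel (quot g) s) (relabel (quot g) s')" for bs' j s s'
      using that
    proof (induction bs' arbitrary: j s s')
      case Nil
      then show ?case by simp
    next
      case (Cons b bs')
      show ?case
      proof (cases "exhausted P j s")
        case True
        then show ?thesis using exh Cons.prems by blast
      next
        case False
        \<comment> \<open>The empty cascade extracts from \<open>exh\<close> just the transfer of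
          exhaustedness.\<close>
        then have False': "\<not> exhausted P j s'"
          using exh[of j s' "[]" s] Cons.prems(6,7) sim_k_sym by auto
        have P: "\<not> P s" "\<not> P s'" using False False' exhausted_if by blast+
        have \<Gamma>s: "\<alpha> s \<in> \<Gamma>" "\<alpha> s' \<in> \<Gamma>"
          using P Cons.prems(4,5) by (auto simp: \<Gamma> P_def alpha_in)
        have IH: "casc_rev bs' (?N j s) = casc_rev bs' (?N j s')"
          using Cons by simp
        have "b (relabel (casc_rev bs') (?N j s)) = b (relabel (casc_rev bs') (?N j s'))"
        proof (cases "U1_hom b")
          case True
          \<comment> \<open>The truncated forest contains \<open>u\<close> and has value in
            \<Gamma>, so stability gives the layer its value at \<open>u\<close>.\<close>
          have "b (relabel (casc_rev bs') (?N j s)) = b (relabel (casc_rev bs') u)"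
            if "reach V g (\<alpha> s)" "\<not> exhausted P j s" "\<alpha> s \<in> \<Gamma>" for s
            using N_fill[OF that(1,2)] N[OF that(1)] that(3) Cons.prems(3) True
            by (metis stable.simps(2))
          then show ?thesis using Cons.prems(4,5) False False' \<Gamma>s by simp
        next
          case one: False
          \<comment> \<open>The layer compares roots and lower values of children, which costs one
            level; the length bound makes \<open>j\<close> positive.\<close>
          obtain i where j: "j = Suc i" "length bs' \<le> i"
            using Cons.prems(1) by (cases j) auto
          have IH': "casc_rev bs' (?N i (kids t)) = casc_rev bs' (?N i (kids t'))"
            if "t \<in> set s" "t' \<in> set s'" "quot g (kids t) = quot g (kids t')"
              "sim_k i (relabel (quot g) (kids t)) (relabel (quot g) (kids t'))" for t t'
            using Cons.IH[OF j(2)] Cons.prems that good_kids by simp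
          have "rel_set (\<lambda>t t'. root t = root t' \<and>
              casc_rev bs' (?N i (kids t)) = casc_rev bs' (?N i (kids t'))) (set s) (set s')"
            using Cons.prems(7) IH' unfolding j(1) sim_k_Suc_relabel rel_set_def by metis
          then have "rel_set (\<lambda>t t'. root t = root t' \<and> casc_rev bs' (kids t) = casc_rev bs' (kids t'))
              (set (?N j s)) (set (?N j s'))"
            unfolding j(1) using P by (rule rel_set_map_trunc)
          moreover have "one_definite_hom b" using one Cons.prems(2) by simp
          ultimately show ?thesis by (intro one_definite_relabel_cong)
        qed
        with IH show ?thesis by simp
      qed
    qed
    have s: "\<alpha> s1 \<in> \<Gamma>" "\<alpha> s2 \<in> \<Gamma>"
      and sim: "sim_k (Suc (length bs)) (relabel (quot g) s1) (relabel (quot g) s2)"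
      using eq unfolding equiv_akG_def \<Gamma>_def by auto
    have good: "reach V g (\<alpha> s1)" "reach V g (\<alpha> s2)" and "\<not> P s1" "\<not> P s2"
      using s by (auto simp: \<Gamma> P_def)
    \<comment> \<open>Both values lie in \<Gamma>, so both quotients are
      \<open>None\<close>.\<close>
    then have "casc_rev bs (?N (Suc (length bs)) s1) = casc_rev bs (?N (Suc (length bs)) s2)"
      using main[OF _ bs u good _ sim] quot by simp
    then have "\<alpha> (?N (Suc (length bs)) s1) = \<alpha> (?N (Suc (length bs)) s2)"
      using fact unfolding factors_through_def by blast
    then show ?thesis unfolding N[OF good(1)] N[OF good(2)] .
  qed
  then show ?thesis
    unfolding nonconfusing_def reach_classes_eq by blast
qed

end

section \<open>Nonconfusing homomorphisms are \<open>(EF,EX)\<close>-homomorphisms\<close>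

locale ici_forest_hom = surj_forest_hom H add zero V \<alpha>
  for H :: "'h set" and add zero V and \<alpha> :: "('a::finite) forest \<Rightarrow> 'h" +
  assumes fin: "finite H"
    and idem: "\<forall>h\<in>H. add h h = h"
    and comm: "\<forall>g\<in>H. \<forall>h\<in>H. add g h = add h g"
begin

section \<open>Consequences of horizontal idempotence and commutativity\<close>

lemma add_assoc: "f \<in> H \<Longrightarrow> g \<in> H \<Longrightarrow> h \<in> H \<Longrightarrow> add (add f g) h = add f (add g h)"
  using algebra unfolding forest_algebra_def by simp

lemma add_alpha_absorb: "t \<in> set s \<Longrightarrow> add (\<alpha> [t]) (\<alpha> s) = \<alpha> s"
proof (induction s)
  case (Cons u s)
  have eq: "\<alpha> (u # s) = add (\<alpha> [u]) (\<alpha> s)" using alpha_append[of "[u]" s] by simp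
  show ?case
  proof (cases "t = u")
    case True
    then show ?thesis using idem alpha_in by (simp add: eq add_assoc[symmetric])
  next
    case False
    have "add (\<alpha> [t]) (add (\<alpha> [u]) (\<alpha> s)) = add (add (\<alpha> [u]) (\<alpha> [t])) (\<alpha> s)"
      using comm alpha_in add_assoc by metis
    then show ?thesis using Cons False alpha_in by (simp add: eq add_assoc)
  qed
qed simp

lemma add_alpha_absorb_forest:
  "(\<And>t. t \<in> set s \<Longrightarrow> \<exists>t'\<in>set s'. \<alpha> [t] = \<alpha> [t']) \<Longrightarrow> add (\<alpha> s) (\<alpha> s') = \<alpha> s'"
proof (induction s)
  case Nil
  then show ?case using hom algebra alpha_in unfolding forest_hom_def forest_algebra_def by simp
next
  case (Cons u s)
  have "\<alpha> (u # s) = add (\<alpha> [u]) (\<alpha> s)" using alpha_append[of "[u]" s] by simp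
  moreover have "add (\<alpha> [u]) (\<alpha> s') = \<alpha> s'" using Cons.prems[of u] add_alpha_absorb by auto
  ultimately show ?case using Cons alpha_in by (simp add: add_assoc)
qed

text \<open>A sum absorbs each of its summands, so matched forests absorb each other; commutativity
  then makes their values equal.\<close>

lemma alpha_rel_set_cong:
  assumes "rel_set (\<lambda>t t'. root t = root t' \<and> \<alpha> (kids t) = \<alpha> (kids t')) (set s) (set s')"
  shows "\<alpha> s = \<alpha> s'"
proof -
  have "rel_set (\<lambda>t t'. \<alpha> [t] = \<alpha> [t']) (set s) (set s')"
    using assms alpha_tree_cong unfolding rel_set_def by metis
  then have "add (\<alpha> s) (\<alpha> s') = \<alpha> s'" "add (\<alpha> s') (\<alpha> s) = \<alpha> s"
    unfolding rel_set_def by (metis add_alpha_absorb_forest)+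
  then show ?thesis using comm alpha_in by metis
qed

text \<open>The invariant for adding classes: values outside \<open>X\<close> may be confused with
  each other, but not with values in \<open>X\<close>. It is trivial for \<open>X = {}\<close>; for
  \<open>X = H\<close> it says that \<alpha> factors through the cascade.\<close>

definition determines :: "(('a \<times> nat list) forest \<Rightarrow> nat) list \<Rightarrow> 'h set \<Rightarrow> bool" where
  "determines bs X \<longleftrightarrow> (\<forall>s s'. casc_rev bs s = casc_rev bs s' \<longrightarrow>
     \<alpha> s = \<alpha> s' \<or> (\<alpha> s \<notin> X \<and> \<alpha> s' \<notin> X))"

text \<open>Among forests with value in or above the class of \<open>g\<close>, \<open>k + 1\<close> layers of root sets
  determine the value. Leaving this set of forests is a local event at a
  minimal subforest, so it can be detected by one further \<open>U\<^sub>1\<close> layer.\<close>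

lemma determines_extend:
  assumes g: "g \<in> H"
    and nonconf: "\<And>s s'. equiv_akG H V \<alpha> k (reach_class g) s s' \<Longrightarrow> \<alpha> s = \<alpha> s'"
    and bs: "\<forall>b\<in>set bs. EF_EX_layer b"
    and det: "determines bs X"
    and X: "\<And>h. h \<in> H \<Longrightarrow> reach V g h \<Longrightarrow> \<not> reach V h g \<Longrightarrow> h \<in> X"
  shows "\<exists>bs'. (\<forall>b\<in>set bs'. EF_EX_layer b) \<and> determines bs' (X \<union> reach_class g)"
proof -
  define good where "good s \<longleftrightarrow> reach V g (\<alpha> s)" for s
  define bsk where "bsk = replicate k (roots_layer :: ('a \<times> nat list) forest \<Rightarrow> nat) @ bs"
  \<comment> \<open>The extra root layer lets a forest be compared through the
    \<open>bsk\<close>-values of its children, as \<open>bad_detected\<close> requires.\<close>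
  define cs where "cs = roots_layer # bsk"
  \<comment> \<open>A label in \<open>B\<close> certifies a bad child forest: no good forest has
    that \<open>cs\<close>-value.\<close>
  define B :: "('a \<times> nat list) set" where "B = {(a, v). v \<notin> casc_rev cs ` {s. good s}}"
  let ?U = "\<lambda>s. label_layer B (relabel (casc_rev cs) s)"
  have cs_eq: "cs = replicate (Suc k) roots_layer @ bs" unfolding cs_def bsk_def by simp
  \<comment> \<open>Values strictly above the class lie in \<open>X\<close>; two distinct values
    that \<open>bs\<close> confuses are outside \<open>X\<close>, hence both quotients are
    \<open>None\<close>.\<close>
  have quot: "quot g s = quot g s'" if "casc_rev bs s = casc_rev bs s'" for s s'
  proof (cases "\<alpha> s = \<alpha> s'")
    case False
    then have "\<alpha> s \<notin> X" "\<alpha> s' \<notin> X" using det that unfolding determines_def by blast+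
    then show ?thesis using X alpha_in by (auto simp: quot_eq[OF g])
  qed (simp add: quot_eq[OF g])
  have good_kids: "good (kids t)" if "t \<in> set s" "good s" for t s
    using reach_kids[OF that(1)] that(2) unfolding good_def by (blast intro: reach_trans)
  have good_eq: "\<alpha> s = \<alpha> s'" if "good s" "good s'" "casc_rev bsk s = casc_rev bsk s'" for s s'
  proof (cases "quot g s")
    case None
    have "quot g s = quot g s'"
      using quot that(3) casc_rev_replicate_roots_layer unfolding bsk_def by blast
    then have "\<alpha> s \<in> reach_class g" "\<alpha> s' \<in> reach_class g"
      using None that(1,2) alpha_in unfolding quot_eq[OF g]
      by (auto simp: reach_class_def good_def split: if_splits)
    moreover have "sim_k k (relabel (quot g) s) (relabel (quot g) s')"
      using sim_k_if_casc_rev_eq[of bs "quot g", OF quot] that(3) unfolding bsk_def by blast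
    ultimately show ?thesis using nonconf unfolding equiv_akG_def by blast
  next
    case (Some h)
    have "quot g s = quot g s'"
      using quot that(3) casc_rev_replicate_roots_layer unfolding bsk_def by blast
    with Some show ?thesis by (auto simp: quot_eq[OF g] split: if_splits)
  qed
  have U_iff: "?U s = 1 \<longleftrightarrow> (\<exists>t\<in>set s. casc_rev cs (kids t) \<notin> casc_rev cs ` {s. good s} \<or> ?U (kids t) = 1)"
    for s
  proof -
    have "has_label B (relabel_tree (casc_rev cs) t) \<longleftrightarrow>
        casc_rev cs (kids t) \<notin> casc_rev cs ` {s. good s} \<or> ?U (kids t) = 1" for t
      by (subst has_label_iff) (simp add: B_def label_layer_def)
    then show ?thesis by (subst label_layer_def) (simp add: relabel_def)
  qed
  \<comment> \<open>Labels record values of child forests, never of \<open>s\<close> itself, hence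
    the first disjunct. If all children are good, a good forest with the same
    \<open>cs\<close>-value would have matching children, hence the same value by
    \<open>good_eq\<close>; otherwise a bad child is detected by induction.\<close>
  have bad_detected: "casc_rev cs s \<notin> casc_rev cs ` {s. good s} \<or> ?U s = 1" if "\<not> good s" for s
    using that
  proof (induction s rule: forest_induct)
    case (forest s)
    show ?case
    proof (cases "\<forall>t\<in>set s. good (kids t)")
      case True
      have False if "good s'" "casc_rev cs s = casc_rev cs s'" for s'
      proof -
        have "rel_set (\<lambda>t t'. root t = root t' \<and> casc_rev bsk (kids t) = casc_rev bsk (kids t'))
            (set s) (set s')"
          using that(2) unfolding cs_def casc_rev_roots_layer_eq_iff by blast
        then have "rel_set (\<lambda>t t'. root t = root t' \<and> \<alpha> (kids t) = \<alpha> (kids t')) (set s) (set s')"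
          using True good_kids[OF _ that(1)] good_eq unfolding rel_set_def by metis
        then have "\<alpha> s = \<alpha> s'" by (rule alpha_rel_set_cong)
        then show False using that(1) forest.prems unfolding good_def by simp
      qed
      then show ?thesis by blast
    next
      case False
      then show ?thesis using forest.IH U_iff[of s] by blast
    qed
  qed
  \<comment> \<open>All child forests of a good forest are good, so no label falls in
    \<open>B\<close>.\<close>
  have good_not_detected: "?U s \<noteq> 1" if "good s" for s
    using that
  proof (induction s rule: forest_induct)
    case (forest s)
    then show ?case using U_iff[of s] good_kids by blast
  qed
  have good_cong: "good s \<longleftrightarrow> good s'"
    if "casc_rev (label_layer B # cs) s = casc_rev (label_layer B # cs) s'" for s s'
  proof -
    have *: "casc_rev cs s = casc_rev cs s'" "?U s = ?U s'"
      using that unfolding casc_rev_Cons_eq_iff by auto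
    have "good s \<longleftrightarrow> casc_rev cs s \<in> casc_rev cs ` {s. good s} \<and> ?U s \<noteq> 1" for s
      using bad_detected[of s] good_not_detected[of s] by blast
    then show ?thesis using * by metis
  qed
  have "determines (label_layer B # cs) (X \<union> reach_class g)"
    unfolding determines_def
  proof (intro allI impI)
    fix s s'
    assume eq: "casc_rev (label_layer B # cs) s = casc_rev (label_layer B # cs) s'"
    then have cs: "casc_rev cs s = casc_rev cs s'" and bsk: "casc_rev bsk s = casc_rev bsk s'"
      unfolding casc_rev_Cons_eq_iff cs_def by auto
    show "\<alpha> s = \<alpha> s' \<or> (\<alpha> s \<notin> X \<union> reach_class g \<and> \<alpha> s' \<notin> X \<union> reach_class g)"
    proof (cases "good s")
      case True
      then show ?thesis using good_eq good_cong[OF eq] bsk by blast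
    next
      case False
      then have "\<alpha> s \<notin> reach_class g" "\<alpha> s' \<notin> reach_class g"
        using good_cong[OF eq] by (auto simp: good_def reach_class_def)
      moreover have "casc_rev bs s = casc_rev bs s'"
        using casc_rev_replicate_roots_layer cs unfolding cs_eq by blast
      ultimately show ?thesis using det unfolding determines_def by blast
    qed
  qed
  moreover have "\<forall>b\<in>set (label_layer B # cs). EF_EX_layer b"
    using bs by (auto simp: cs_eq U1_label_layer one_definite_roots_layer)
  ultimately show ?thesis by blast
qed

lemma determines_all:
  assumes "nonconfusing H V \<alpha>"
  shows "\<exists>bs. (\<forall>b\<in>set bs. EF_EX_layer b) \<and> determines bs H"
proof -
  obtain k where k: "\<And>g s s'. g \<in> H \<Longrightarrow> equiv_akG H V \<alpha> k (reach_class g) s s' \<Longrightarrow> \<alpha> s = \<alpha> s'"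
    using assms unfolding nonconfusing_def reach_classes_eq by blast
  have "\<exists>bs'. (\<forall>b\<in>set bs'. EF_EX_layer b) \<and> determines bs' H"
    if "\<forall>b\<in>set bs. EF_EX_layer b" "determines bs X" for bs X
    using that
  proof (induction "card (H - X)" arbitrary: bs X rule: less_induct)
    case less
    show ?case
    proof (cases "H \<subseteq> X")
      case True
      then show ?thesis using less.prems unfolding determines_def by blast
    next
      case False
      let ?up = "\<lambda>g. {h \<in> H. reach V g h}"
      \<comment> \<open>Fewest elements above it makes \<open>g\<close> maximal in
        \<open>H - X\<close> up to equivalence: a strictly higher element has a strictly smaller
        up-set.\<close>
      obtain g where g: "g \<in> H - X" and min: "\<And>h. h \<in> H - X \<Longrightarrow> card (?up g) \<le> card (?up h)"
        using arg_min_nat_lemma[of "\<lambda>h. h \<in> H - X" _ "\<lambda>g. card (?up g)"] False by blast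
      have "h \<in> X" if "h \<in> H" "reach V g h" "\<not> reach V h g" for h
      proof (rule ccontr)
        assume "h \<notin> X"
        then have "card (?up g) \<le> card (?up h)" using min that by blast
        moreover have "?up h \<subset> ?up g" using that g reach_refl reach_trans by blast
        then have "card (?up h) < card (?up g)" using fin by (intro psubset_card_mono) auto
        ultimately show False by simp
      qed
      then obtain bs' where bs': "\<forall>b\<in>set bs'. EF_EX_layer b" "determines bs' (X \<union> reach_class g)"
        using determines_extend[OF _ k[of g] less.prems] g by blast
      have "g \<in> reach_class g" using g reach_refl by (simp add: reach_class_def)
      then have "H - (X \<union> reach_class g) \<subset> H - X" using g by blast
      then have "card (H - (X \<union> reach_class g)) < card (H - X)"
        using fin by (intro psubset_card_mono) auto
      then show ?thesis using less.hyps bs' by blast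
    qed
  qed
  from this[of "[]" "{}"] show ?thesis unfolding determines_def by simp
qed

end

theorem theorem3:
  fixes H :: "'h set" and add :: "'h \<Rightarrow> 'h \<Rightarrow> 'h" and zero :: 'h
    and V :: "('h \<Rightarrow> 'h) set" and \<alpha> :: "('a::finite) forest \<Rightarrow> 'h"
  assumes hom: "forest_hom H add zero V \<alpha>"
    and surj: "forest_hom_surj H V \<alpha>"
    and fin: "finite H"
    and idem: "\<forall>h\<in>H. add h h = h"
    and comm: "\<forall>g\<in>H. \<forall>h\<in>H. add g h = add h g"
  shows "EF_EX_hom \<alpha> \<longleftrightarrow> nonconfusing H V \<alpha>"
proof -
  interpret ici_forest_hom H add zero V \<alpha>
    using assms by unfold_locales
  show ?thesis
  proof
    assume "EF_EX_hom \<alpha>"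
    then obtain bs where "\<forall>b\<in>set bs. EF_EX_layer b" "factors_through \<alpha> (cascade bs)"
      unfolding EF_EX_hom_def by blast
    then show "nonconfusing H V \<alpha>"
      using nonconfusing_if_factors_through[of "rev bs"] unfolding cascade_def by simp
  next
    assume "nonconfusing H V \<alpha>"
    then obtain bs where bs: "\<forall>b\<in>set bs. EF_EX_layer b" "determines bs H"
      using determines_all by blast
    then have "factors_through \<alpha> (cascade (rev bs))"
      using alpha_in unfolding factors_through_def determines_def cascade_def rev_rev_ident by blast
    then show "EF_EX_hom \<alpha>"
      using bs(1) unfolding EF_EX_hom_def by (intro exI[of _ "rev bs"]) simp
  qed
qed

end
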